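(* Let $(X,\Sigma,\nu)$ be a probability space and let $T:X\to X$ be a measurable transformation preserving $\nu$. Let $\mu_{T,\nu}$ be the push-forward of $\nu$ under the measurable map $\hat{T}:X\to X^\infty$, $\hat{T}(x)=(x,T(x),T^2(x),\ldots)$. Then $$H^{ip}(\mu_{T,\nu})=H^{sh}(T,\nu).$$
   Context: Let $(X,\Sigma)$ be a measurable space; $X^\infty=\prod_{n=0}^\infty X$ carries the product $\sigma$-algebra $\Sigma^\infty$. A partition of a measurable space is a finite collection of pairwise disjoint measurable sets whose union is the whole space. For a probability measure $\nu$ and a partition $\mathcal{P}=\{A_i\}_{i=1}^k$, the Shannon entropy is $H^{sh}(\nu,\mathcal{P})=-\sum_{i=1}^k\nu(A_i)\log\nu(A_i)$ (with $0\log 0=0$). For partitions, $\mathcal{P}\vee\mathcal{Q}=\{A_i\cap B_j\}_{i,j}$. For $T$ preserving $\nu$ (i.e. $\nu(T^{-1}A)=\nu(A)$ for all $A\in\Sigma$), $H^{sh}(T,\nu,\mathcal{P})=\lim_{n\to\infty}\frac1n H^{sh}(\nu,\bigvee_{i=0}^{n-1}T^{-i}\mathcal{P})$ and $H^{sh}(T,\nu)=\sup_{\mathcal{P}}H^{sh}(T,\nu,\mathcal{P})$, the supremum over all partitions of $X$. For $A_0,\ldots,A_{n-1}\in\Sigma$ put $\overline{A_0\cdots A_{n-1}}=A_0\times\cdots\times A_{n-1}\times X\times X\times\cdots\subseteq X^\infty$; for a partition $\mathcal{P}=\{A_i\}_{i\in I}$ of $X$ let $\overline{\mathcal{P}}^n=\{\overline{A_{i_0}\cdots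 A_{i_{n-1}}}:i_0,\ldots,i_{n-1}\in I\}$, a partition of $X^\infty$. For a probability measure $\mu$ on $(X^\infty,\Sigma^\infty)$, the infinite-product entropy is defined by $H^{ip}(\mu,\mathcal{P})=\limsup_{n\to\infty}\frac1n H^{sh}(\mu,\overline{\mathcal{P}}^n)$ and $H^{ip}(\mu)=\sup_{\mathcal{P}}H^{ip}(\mu,\mathcal{P})\in[0,\infty]$, the supremum over all partitions $\mathcal{P}$ of $X$. *)

theory Defs
  imports "HOL-Probability.Probability"
begin

text \<open>
  A measurable space \<open>(X, \<Sigma>)\<close> is given as a measure \<open>M\<close> with \<open>X = space M\<close> and
  \<open>\<Sigma> = sets M\<close>. All logarithms are natural, and \<open>ln 0 = 0\<close> gives \<open>0 log 0 = 0\<close>.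
\<close>

text \<open>Unlike \<^const>\<open>partition_on\<close>, the empty set is allowed as a member.\<close>
definition is_partition :: "'a measure \<Rightarrow> 'a set set \<Rightarrow> bool" where
  "is_partition M P \<longleftrightarrow> finite P \<and> P \<subseteq> sets M \<and> disjoint P \<and> \<Union>P = space M"

text \<open>
  Partitions are sets rather than indexed families. In the constructions below, distinct indices
  can yield equal members only if these are empty, and the empty set contributes 0 to the sum.
\<close>
definition shannon_entropy :: "'a measure \<Rightarrow> 'a set set \<Rightarrow> real" where
  "shannon_entropy \<nu> P = - (\<Sum>A\<in>P. measure \<nu> A * ln (measure \<nu> A))"

definition partition_join :: "'a set set \<Rightarrow> 'a set set \<Rightarrow> 'a set set" where
  "partition_join P Q = {A \<inter> B | A B. A \<in> P \<and> B \<in> Q}"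

definition pullback_partition ::
    "'a measure \<Rightarrow> ('a \<Rightarrow> 'a) \<Rightarrow> 'a set set \<Rightarrow> 'a set set" where
  "pullback_partition M S P = (\<lambda>A. S -` A \<inter> space M) ` P"

text \<open>The join of \<open>T\<^sup>-\<^sup>i P\<close> over \<open>i < n\<close>; the empty join is the trivial partition.\<close>
primrec iterated_join ::
    "'a measure \<Rightarrow> ('a \<Rightarrow> 'a) \<Rightarrow> 'a set set \<Rightarrow> nat \<Rightarrow> 'a set set" where
  "iterated_join M T P 0 = {space M}"
| "iterated_join M T P (Suc n) =
     partition_join (iterated_join M T P n) (pullback_partition M (T ^^ n) P)"

definition ks_entropy_partition ::
    "'a measure \<Rightarrow> ('a \<Rightarrow> 'a) \<Rightarrow> 'a set set \<Rightarrow> ereal" where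
  "ks_entropy_partition \<nu> T P =
     lim (\<lambda>n. ereal (1 / real n * shannon_entropy \<nu> (iterated_join \<nu> T P n)))"

definition ks_entropy :: "'a measure \<Rightarrow> ('a \<Rightarrow> 'a) \<Rightarrow> ereal" where
  "ks_entropy \<nu> T = (SUP P\<in>{P. is_partition \<nu> P}. ks_entropy_partition \<nu> T P)"

abbreviation infinite_product :: "'a measure \<Rightarrow> (nat \<Rightarrow> 'a) measure" where
  "infinite_product M \<equiv> Pi\<^sub>M UNIV (\<lambda>_. M)"

definition cylinder :: "'a measure \<Rightarrow> nat \<Rightarrow> (nat \<Rightarrow> 'a set) \<Rightarrow> (nat \<Rightarrow> 'a) set" where
  "cylinder M n A = Pi\<^sub>E UNIV (\<lambda>i. if i < n then A i else space M)"

definition cylinder_partition ::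
    "'a measure \<Rightarrow> nat \<Rightarrow> 'a set set \<Rightarrow> (nat \<Rightarrow> 'a) set set" where
  "cylinder_partition M n P = cylinder M n ` ({..<n} \<rightarrow>\<^sub>E P)"

text \<open>
  In the next two definitions \<open>\<mu>\<close> is a probability measure on \<^term>\<open>infinite_product M\<close>; of \<open>M\<close>
  only the underlying measurable space is used.
\<close>
definition ip_entropy_partition ::
    "'a measure \<Rightarrow> (nat \<Rightarrow> 'a) measure \<Rightarrow> 'a set set \<Rightarrow> ereal" where
  "ip_entropy_partition M \<mu> P =
     limsup (\<lambda>n. ereal (1 / real n * shannon_entropy \<mu> (cylinder_partition M n P)))"

definition ip_entropy :: "'a measure \<Rightarrow> (nat \<Rightarrow> 'a) measure \<Rightarrow> ereal" where
  "ip_entropy M \<mu> = (SUP P\<in>{P. is_partition M P}. ip_entropy_partition M \<mu> P)"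

definition orbit_map :: "('a \<Rightarrow> 'a) \<Rightarrow> 'a \<Rightarrow> nat \<Rightarrow> 'a" where
  "orbit_map T x = (\<lambda>n. (T ^^ n) x)"

definition orbit_measure :: "'a measure \<Rightarrow> ('a \<Rightarrow> 'a) \<Rightarrow> (nat \<Rightarrow> 'a) measure" where
  "orbit_measure \<nu> T = distr \<nu> (infinite_product \<nu>) (orbit_map T)"

end

theory Submission
  imports Defs
begin

text \<open>
  The map \<open>x \<mapsto> (x, T x, T\<^sup>2 x, \<dots>)\<close> pulls the \<open>n\<close>-cylinders over \<open>P\<close> back to the join
  of \<open>T\<^sup>-\<^sup>i P\<close> over \<open>i < n\<close>, so both entropies are built from the same sequence \<open>a\<^sub>n\<close> of
  Shannon entropies. They differ only in taking the upper limit or the limit of \<open>a\<^sub>n / n\<close>. That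
  limit exists by Fekete's lemma, since \<open>T\<close>-invariance and the subadditivity of
  Shannon entropy under joins make \<open>a\<^sub>n\<close> subadditive.
\<close>

section \<open>Fekete's lemma\<close>

lemma subadditive_mult_add_le:
  fixes a :: "nat \<Rightarrow> real"
  assumes "\<And>m n. a (m + n) \<le> a m + a n"
  shows "a (q * m + r) \<le> real q * a m + a r"
proof (induction q)
  case (Suc q)
  have "a (Suc q * m + r) = a (m + (q * m + r))"
    by (simp add: algebra_simps)
  also have "\<dots> \<le> a m + a (q * m + r)"
    by (rule assms)
  finally show ?case
    using Suc by (simp add: algebra_simps)
qed simp

text \<open>The limit is the infimum of the ratios over positive indices. Nonnegativity keeps that
  infimum finite.\<close>

lemma subadditive_ratio_convergent:
  fixes a :: "nat \<Rightarrow> real"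
  assumes sub: "\<And>m n. a (m + n) \<le> a m + a n"
    and nonneg: "\<And>n. 0 \<le> a n"
  shows "convergent (\<lambda>n. a n / real n)"
proof -
  define L where "L = (INF n\<in>{1..}. a n / real n)"
  have bdd: "bdd_below ((\<lambda>n. a n / real n) ` {1..})"
    using nonneg by (intro bdd_belowI2[where m = 0]) simp
  have lower: "L \<le> a n / real n" if "1 \<le> n" for n
    unfolding L_def using bdd that by (intro cINF_lower) auto
  have "(\<lambda>n. a n / real n) \<longlonglongrightarrow> L"
  proof (rule order_tendstoI)
    fix y assume "y < L"
    then show "\<forall>\<^sub>F n in sequentially. y < a n / real n"
      using lower by (intro eventually_sequentiallyI[of 1]) (force intro: less_le_trans)
  next
    fix y assume "L < y"
    then obtain m where m: "1 \<le> m" "a m / real m < y"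
      unfolding L_def using bdd by (subst (asm) cINF_less_iff) auto
    \<comment> \<open>Write \<open>n\<close> as a multiple of \<open>m\<close> plus a remainder
      below \<open>m\<close>. \<open>C\<close> bounds the remainder's contribution independently of
      \<open>n\<close>, so it vanishes after division by \<open>n\<close>.\<close>
    define C where "C = Max (a ` {..<m})"
    have upper: "a n / real n \<le> a m / real m + C / real n" if n: "1 \<le> n" for n
    proof -
      have "a n \<le> real (n div m) * a m + a (n mod m)"
        using subadditive_mult_add_le[of a "n div m" m "n mod m", OF sub] by simp
      also have "\<dots> \<le> real n / real m * a m + C"
      \<comment> \<open>Replacing \<open>n div m\<close> by the larger \<open>n / m\<close> uses
        \<open>0 \<le> a m\<close>.\<close>
      proof (intro add_mono mult_right_mono nonneg)
        show "real (n div m) \<le> real n / real m"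
          by (rule of_nat_div_le_of_nat)
        show "a (n mod m) \<le> C"
          unfolding C_def using m by (intro Max_ge) auto
      qed
      finally show ?thesis
        using n by (simp add: field_simps)
    qed
    have "(\<lambda>n. a m / real m + C / real n) \<longlonglongrightarrow> a m / real m + 0"
      by (intro tendsto_intros lim_const_over_n)
    then have "\<forall>\<^sub>F n in sequentially. a m / real m + C / real n < y"
      using m by (intro order_tendstoD) auto
    then show "\<forall>\<^sub>F n in sequentially. a n / real n < y"
      using eventually_ge_at_top[of 1]
      by eventually_elim (use upper in \<open>force intro: le_less_trans\<close>)
  qed
  then show ?thesis
    by (rule convergentI)
qed

section \<open>Shannon entropy of partitions\<close>

lemma partition_join_image:
  "partition_join (f ` I) (g ` J) = (\<lambda>(i, j). f i \<inter> g j) ` (I \<times> J)"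
  unfolding partition_join_def by fast

lemma partition_join_eq_image:
  "partition_join P Q = (\<lambda>(A, B). A \<inter> B) ` (P \<times> Q)"
  using partition_join_image[of "\<lambda>A. A" P "\<lambda>B. B" Q] by simp

lemma partition_join_assoc:
  "partition_join (partition_join P Q) R = partition_join P (partition_join Q R)"
proof -
  have "partition_join (partition_join P Q) R = {A \<inter> B \<inter> C | A B C. A \<in> P \<and> B \<in> Q \<and> C \<in> R}"
    unfolding partition_join_def by blast
  also have "\<dots> = partition_join P (partition_join Q R)"
    unfolding partition_join_def Int_assoc by blast
  finally show ?thesis .
qed

lemma is_partition_join:
  assumes "is_partition M P" "is_partition M Q"
  shows "is_partition M (partition_join P Q)"
proof -
  have "disjoint (partition_join P Q)"
    using assms unfolding is_partition_def disjoint_def partition_join_def by blast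
  moreover have "\<Union>(partition_join P Q) = \<Union>P \<inter> \<Union>Q"
    unfolding partition_join_def by blast
  moreover have "finite (partition_join P Q)"
    using assms by (auto simp: is_partition_def partition_join_eq_image)
  ultimately show ?thesis
    using assms by (auto simp: is_partition_def partition_join_def)
qed

lemma is_partition_pullback:
  assumes "S \<in> measurable M M" "is_partition M P"
  shows "is_partition M (pullback_partition M S P)"
proof -
  have "disjoint (pullback_partition M S P)"
    unfolding pullback_partition_def
  proof (rule disjointI, elim imageE)
    fix C D A B assume "A \<in> P" "B \<in> P" "C \<noteq> D" "C = S -` A \<inter> space M" "D = S -` B \<inter> space M"
    moreover from this have "A \<inter> B = {}"
      using assms(2) unfolding is_partition_def disjoint_def by metis
    ultimately show "C \<inter> D = {}"
      by blast
  qed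
  moreover have "\<Union>(pullback_partition M S P) = S -` \<Union>P \<inter> space M"
    unfolding pullback_partition_def by blast
  ultimately show ?thesis
    using assms measurable_space[OF assms(1)]
    by (auto simp: is_partition_def pullback_partition_def)
qed

text \<open>As a set, the join may merge several pairs into one member, but only when their common
  intersection is empty; there \<open>f\<close> vanishes.\<close>

lemma sum_partition_join:
  fixes f :: "'a set \<Rightarrow> real"
  assumes "is_partition M P" "is_partition M Q" "f {} = 0"
  shows "(\<Sum>C\<in>partition_join P Q. f C) = (\<Sum>A\<in>P. \<Sum>B\<in>Q. f (A \<inter> B))"
proof -
  have "(\<Sum>C\<in>partition_join P Q. f C) = (\<Sum>z\<in>P \<times> Q. f (case z of (A, B) \<Rightarrow> A \<inter> B))"
    unfolding partition_join_eq_image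
  proof (subst sum.reindex_nontrivial)
    fix y z assume "y \<in> P \<times> Q" "z \<in> P \<times> Q" "y \<noteq> z"
      and eq: "(case y of (A, B) \<Rightarrow> A \<inter> B) = (case z of (A, B) \<Rightarrow> A \<inter> B)"
    \<comment> \<open>Distinct pairs differ in a component, and distinct members of a partition are
      disjoint. The common intersection lies in both of these sets.\<close>
    then have "fst y \<inter> fst z = {} \<or> snd y \<inter> snd z = {}"
      using assms(1,2) unfolding is_partition_def disjoint_def by (metis mem_Times_iff prod_eqI)
    then have "(case y of (A, B) \<Rightarrow> A \<inter> B) = {}"
      using eq by (auto simp: split_beta)
    then show "f (case y of (A, B) \<Rightarrow> A \<inter> B) = 0"
      using assms(3) by simp
  qed (use assms in \<open>auto simp: is_partition_def o_def\<close>)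
  then show ?thesis
    by (simp add: sum.cartesian_product split_beta)
qed

text \<open>Disjoint sets share a preimage only if it is empty, which adds nothing to the entropy.
  This serves twice: with \<open>S = T ^^ m\<close> for invariance and with the orbit map for the
  push-forward.\<close>

lemma shannon_entropy_vimage:
  assumes "disjoint Q" "finite Q"
    and "\<And>A. A \<in> Q \<Longrightarrow> measure \<nu> (S -` A \<inter> space \<nu>) = measure \<mu> A"
  shows "shannon_entropy \<nu> ((\<lambda>A. S -` A \<inter> space \<nu>) ` Q) = shannon_entropy \<mu> Q"
  unfolding shannon_entropy_def
proof (subst sum.reindex_nontrivial)
  fix A B
  assume "A \<in> Q" "B \<in> Q" "A \<noteq> B" "S -` A \<inter> space \<nu> = S -` B \<inter> space \<nu>"
  then have "S -` A \<inter> space \<nu> = {}"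
    using assms(1) unfolding disjoint_def by blast
  then show "measure \<nu> (S -` A \<inter> space \<nu>) * ln (measure \<nu> (S -` A \<inter> space \<nu>)) = 0"
    by simp
qed (use assms in auto)

section \<open>Subadditivity of Shannon entropy\<close>

context prob_space
begin

lemma shannon_entropy_nonneg: "0 \<le> shannon_entropy M P"
proof -
  have "measure M A * ln (measure M A) \<le> 0" for A
    by (cases "measure M A = 0") (auto intro!: mult_nonneg_nonpos simp: zero_less_measure_iff)
  then show ?thesis
    unfolding shannon_entropy_def by (simp add: sum_nonpos)
qed

lemma sum_prob_Int_partition:
  assumes "is_partition M P" "B \<in> sets M"
  shows "(\<Sum>A\<in>P. prob (B \<inter> A)) = prob B"
proof -
  have "prob (\<Union>A\<in>P. B \<inter> A) = (\<Sum>A\<in>P. prob (B \<inter> A))"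
    using assms
    by (intro finite_measure_finite_Union) (auto simp: is_partition_def disjoint_def disjoint_family_on_def)
  moreover have "(\<Union>A\<in>P. B \<inter> A) = B"
    using assms sets.sets_into_space[OF assms(2)] unfolding is_partition_def by blast
  ultimately show ?thesis
    by simp
qed

text \<open>This is the nonnegativity of mutual information, obtained by applying
  \<open>ln x \<le> x - 1\<close> to each pair of members.\<close>

lemma shannon_entropy_join_le:
  assumes P: "is_partition M P" and Q: "is_partition M Q"
  shows "shannon_entropy M (partition_join P Q) \<le> shannon_entropy M P + shannon_entropy M Q"
proof -
  have meas: "A \<in> sets M" if "A \<in> P \<or> A \<in> Q" for A
    using that P Q by (auto simp: is_partition_def)
  have total: "sum prob R = 1" if "is_partition M R" for R
  proof -
    have "(\<Sum>A\<in>R. prob (space M \<inter> A)) = (\<Sum>A\<in>R. prob A)"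
      using that sets.sets_into_space
      by (intro sum.cong) (auto simp: is_partition_def intro!: arg_cong[where f = prob])
    then show ?thesis
      using sum_prob_Int_partition[OF that sets.top] by (simp add: prob_space)
  qed
  \<comment> \<open>Marginalisation: taking \<open>g\<close> to be the logarithm of
    \<open>prob\<close> recovers the entropy of one factor, and \<open>g = 1\<close> gives the total
    mass.\<close>
  have left: "(\<Sum>A\<in>P. \<Sum>B\<in>Q. prob (A \<inter> B) * g A) = (\<Sum>A\<in>P. prob A * g A)" for g
    using sum_prob_Int_partition[OF Q] meas
    by (intro sum.cong) (simp_all flip: sum_distrib_right)
  have right: "(\<Sum>A\<in>P. \<Sum>B\<in>Q. prob (A \<inter> B) * g B) = (\<Sum>B\<in>Q. prob B * g B)" for g
    using sum_prob_Int_partition[OF P] meas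
    by (subst sum.swap, intro sum.cong) (simp_all add: Int_commute flip: sum_distrib_right)
  \<comment> \<open>Take \<open>x = prob A * prob B / prob (A \<inter> B)\<close> and multiply by
    \<open>prob (A \<inter> B)\<close>. If the intersection is null, the left side is 0 and the
    right side is a product of probabilities.\<close>
  have term_le: "prob (A \<inter> B) * ln (prob A) + prob (A \<inter> B) * ln (prob B)
      - prob (A \<inter> B) * ln (prob (A \<inter> B)) \<le> prob A * prob B - prob (A \<inter> B)"
    if "A \<in> P" "B \<in> Q" for A B
  proof (cases "prob (A \<inter> B) = 0")
    case False
    then have pos: "0 < prob (A \<inter> B)"
      by (simp add: zero_less_measure_iff)
    then have AB: "0 < prob A" "0 < prob B"
      using that meas finite_measure_mono[of "A \<inter> B" A] finite_measure_mono[of "A \<inter> B" B]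
      by auto
    have "prob (A \<inter> B) * ln (prob A * prob B / prob (A \<inter> B))
        \<le> prob (A \<inter> B) * (prob A * prob B / prob (A \<inter> B) - 1)"
      using pos AB by (intro mult_left_mono ln_le_minus_one) auto
    then show ?thesis
      using pos AB by (simp add: ln_div ln_mult algebra_simps)
  qed simp
  have "(\<Sum>A\<in>P. \<Sum>B\<in>Q. prob (A \<inter> B) * ln (prob A) + prob (A \<inter> B) * ln (prob B)
      - prob (A \<inter> B) * ln (prob (A \<inter> B)))
      \<le> (\<Sum>A\<in>P. \<Sum>B\<in>Q. prob A * prob B - prob (A \<inter> B))"
    by (intro sum_mono term_le)
  \<comment> \<open>The product weights and the joint weights both sum to 1.\<close>
  also have "\<dots> = 0"
    using left[of "\<lambda>_. 1"] total[OF P] total[OF Q]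
    by (simp add: sum_subtractf flip: sum_product)
  finally show ?thesis
    unfolding shannon_entropy_def
    by (simp add: sum_partition_join[OF P Q] sum.distrib sum_subtractf left right)
qed

end

section \<open>Iterated joins and cylinders\<close>

lemma funpow_measurable:
  assumes "T \<in> measurable M M"
  shows "(T ^^ n) \<in> measurable M M"
  using assms by (induction n) (auto simp: id_def intro: measurable_comp)

lemma measure_vimage_funpow:
  assumes T: "T \<in> measurable M M"
    and inv: "\<And>A. A \<in> sets M \<Longrightarrow> measure M (T -` A \<inter> space M) = measure M A"
    and A: "A \<in> sets M"
  shows "measure M ((T ^^ n) -` A \<inter> space M) = measure M A"
proof (induction n)
  case 0
  then show ?case
    using sets.sets_into_space[OF A] by (simp add: Int_absorb2)
next
  case (Suc n)
  have "(T ^^ Suc n) -` A \<inter> space M = T -` ((T ^^ n) -` A \<inter> space M) \<inter> space M"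
    using measurable_space[OF T] by (auto simp: funpow_Suc_right simp del: funpow.simps)
  then show ?case
    using Suc inv[OF measurable_sets[OF funpow_measurable[OF T] A]] by (simp only:)
qed

lemma is_partition_iterated_join:
  assumes "T \<in> measurable M M" "is_partition M P"
  shows "is_partition M (iterated_join M T P n)"
proof (induction n)
  case 0
  then show ?case
    by (simp add: is_partition_def disjoint_def)
next
  case (Suc n)
  then show ?case
    using assms by (simp add: is_partition_join is_partition_pullback funpow_measurable)
qed

lemma pullback_partition_join:
  "pullback_partition M S (partition_join P Q)
    = partition_join (pullback_partition M S P) (pullback_partition M S Q)"
  unfolding pullback_partition_def partition_join_image
  unfolding partition_join_eq_image image_image by (rule image_cong) auto

lemma pullback_partition_funpow:
  assumes "T \<in> measurable M M"
  shows "pullback_partition M (T ^^ m) (pullback_partition M (T ^^ n) P)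
    = pullback_partition M (T ^^ (m + n)) P"
proof -
  have "(T ^^ m) -` ((T ^^ n) -` A \<inter> space M) \<inter> space M = (T ^^ (m + n)) -` A \<inter> space M" for A
    using measurable_space[OF funpow_measurable[OF assms]]
    by (auto simp: add.commute[of m] funpow_add)
  then show ?thesis
    unfolding pullback_partition_def image_image by simp
qed

text \<open>The factors with exponents from \<open>m\<close> to \<open>m + n - 1\<close> are those
  of the \<open>n\<close>-fold join pulled back by \<open>T ^^ m\<close>. This splitting yields
  subadditivity of the entropies.\<close>

lemma iterated_join_add:
  assumes "T \<in> measurable M M" "is_partition M P"
  shows "iterated_join M T P (m + n)
    = partition_join (iterated_join M T P m) (pullback_partition M (T ^^ m) (iterated_join M T P n))"
proof (induction n)
  case 0
  have "(T ^^ m) -` space M \<inter> space M = space M"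
    using measurable_space[OF funpow_measurable[OF assms(1)]] by blast
  moreover have "A \<inter> space M = A" if "A \<in> iterated_join M T P m" for A
    using is_partition_iterated_join[OF assms] that unfolding is_partition_def by blast
  ultimately show ?case
    by (auto simp: partition_join_def pullback_partition_def) metis
next
  case (Suc n)
  then show ?case
    using assms by (simp add: pullback_partition_join pullback_partition_funpow partition_join_assoc)
qed

section \<open>Cylinders and the orbit map\<close>

lemma orbit_map_measurable:
  assumes "T \<in> measurable M M"
  shows "orbit_map T \<in> measurable M (infinite_product M)"
  unfolding orbit_map_def using funpow_measurable[OF assms]
  by (intro measurable_PiM_single') (auto dest: measurable_space)

lemma vimage_orbit_map_cylinder:
  assumes "T \<in> measurable M M"
  shows "orbit_map T -` cylinder M n A \<inter> space M = {x \<in> space M. \<forall>i<n. (T ^^ i) x \<in> A i}"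
  using measurable_space[OF funpow_measurable[OF assms]]
  unfolding cylinder_def orbit_map_def by (auto simp: PiE_iff split: if_splits)

text \<open>Both sides run over words of length \<open>n\<close> with letters in \<open>P\<close>; a
  word gives the set of points whose first \<open>n\<close> iterates follow it.\<close>

lemma iterated_join_eq_vimage_cylinder:
  assumes "T \<in> measurable M M"
  shows "iterated_join M T P n = (\<lambda>C. orbit_map T -` C \<inter> space M) ` cylinder_partition M n P"
proof (induction n)
  case 0
  then show ?case
    by (simp add: cylinder_partition_def vimage_orbit_map_cylinder[OF assms])
next
  case (Suc n)
  \<comment> \<open>Appending the letter \<open>B\<close> adds one constraint, on the iterate
    \<open>T ^^ n\<close>.\<close>
  have eq: "orbit_map T -` cylinder M (Suc n) (A(n := B)) \<inter> space M
      = (orbit_map T -` cylinder M n A \<inter> space M) \<inter> ((T ^^ n) -` B \<inter> space M)" for A B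
    by (auto simp: vimage_orbit_map_cylinder[OF assms] less_Suc_eq)
  have "(\<lambda>C. orbit_map T -` C \<inter> space M) ` cylinder_partition M (Suc n) P
      = (\<lambda>(B, A). orbit_map T -` cylinder M (Suc n) (A(n := B)) \<inter> space M)
        ` (P \<times> ({..<n} \<rightarrow>\<^sub>E P))"
    unfolding cylinder_partition_def lessThan_Suc PiE_insert_eq by (simp add: image_image split_beta)
  also have "\<dots> = iterated_join M T P (Suc n)"
    unfolding iterated_join.simps Suc cylinder_partition_def pullback_partition_def image_image
      partition_join_image eq by fast
  finally show ?case
    by simp
qed

lemma cylinder_partition_disjoint:
  assumes "disjoint P"
  shows "disjoint (cylinder_partition M n P)"
  unfolding cylinder_partition_def
proof (rule disjointI)
  fix C D assume "C \<in> cylinder M n ` ({..<n} \<rightarrow>\<^sub>E P)" "D \<in> cylinder M n ` ({..<n} \<rightarrow>\<^sub>E P)"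
    and "C \<noteq> D"
  then obtain A B where AB: "A \<in> {..<n} \<rightarrow>\<^sub>E P" "C = cylinder M n A"
    "B \<in> {..<n} \<rightarrow>\<^sub>E P" "D = cylinder M n B" "A \<noteq> B"
    by blast
  \<comment> \<open>Words in the extensional function space agree beyond \<open>n\<close>, so
    distinct ones differ at a position below \<open>n\<close>.\<close>
  then obtain i where i: "i < n" "A i \<noteq> B i"
    by (metis PiE_ext lessThan_iff)
  then have "A i \<inter> B i = {}"
    using AB assms unfolding disjoint_def by (meson PiE_mem lessThan_iff)
  moreover have "x i \<in> A i \<inter> B i" if "x \<in> C \<inter> D" for x
    using that AB i(1) by (auto simp: cylinder_def PiE_iff split: if_splits)
  ultimately show "C \<inter> D = {}"
    by blast
qed

lemma cylinder_sets:
  assumes "A \<in> {..<n} \<rightarrow>\<^sub>E sets M"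
  shows "cylinder M n A \<in> sets (infinite_product M)"
  unfolding cylinder_def using PiE_mem[OF assms] by (intro sets_PiM_I_countable) auto

lemma shannon_entropy_cylinder_partition:
  assumes T: "T \<in> measurable \<nu> \<nu>" and P: "is_partition \<nu> P"
  shows "shannon_entropy (orbit_measure \<nu> T) (cylinder_partition \<nu> n P)
    = shannon_entropy \<nu> (iterated_join \<nu> T P n)"
  unfolding iterated_join_eq_vimage_cylinder[OF T]
proof (rule shannon_entropy_vimage[symmetric])
  show "disjoint (cylinder_partition \<nu> n P)"
    using P by (simp add: is_partition_def cylinder_partition_disjoint)
  show "finite (cylinder_partition \<nu> n P)"
    using P by (auto simp: is_partition_def cylinder_partition_def intro!: finite_PiE)
  fix C assume "C \<in> cylinder_partition \<nu> n P"
  then have "C \<in> sets (infinite_product \<nu>)"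
    using P by (auto simp: cylinder_partition_def is_partition_def PiE_iff intro!: cylinder_sets)
  then show "measure \<nu> (orbit_map T -` C \<inter> space \<nu>) = measure (orbit_measure \<nu> T) C"
    unfolding orbit_measure_def by (rule measure_distr[OF orbit_map_measurable[OF T], symmetric])
qed

theorem proposition1p2:
  fixes \<nu> :: "'a measure" and T :: "'a \<Rightarrow> 'a"
  assumes "prob_space \<nu>"
    and "T \<in> measurable \<nu> \<nu>"
    and "\<And>A. A \<in> sets \<nu> \<Longrightarrow> measure \<nu> (T -` A \<inter> space \<nu>) = measure \<nu> A"
  shows "ip_entropy \<nu> (orbit_measure \<nu> T) = ks_entropy \<nu> T"
proof -
  interpret prob_space \<nu> by fact
  have "ip_entropy_partition \<nu> (orbit_measure \<nu> T) P = ks_entropy_partition \<nu> T P"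
    if P: "is_partition \<nu> P" for P
  proof -
    define a where "a n = shannon_entropy \<nu> (iterated_join \<nu> T P n)" for n
    note part = is_partition_iterated_join[OF assms(2) P]
    have "a (m + n) \<le> a m + a n" for m n
    proof -
      \<comment> \<open>Here invariance of the measure enters: the second block of a split join has
        the entropy of an unshifted one.\<close>
      have "shannon_entropy \<nu> (pullback_partition \<nu> (T ^^ m) (iterated_join \<nu> T P n)) = a n"
        unfolding a_def pullback_partition_def
        using part[of n] measure_vimage_funpow[OF assms(2,3)]
        by (intro shannon_entropy_vimage) (auto simp: is_partition_def)
      then show ?thesis
        using shannon_entropy_join_le[OF part[of m]
            is_partition_pullback[OF funpow_measurable[OF assms(2)] part[of n]], of m]
        by (simp add: a_def iterated_join_add[OF assms(2) P])
    qed
    then have "convergent (\<lambda>n. a n / real n)"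
      by (rule subadditive_ratio_convergent) (simp add: a_def shannon_entropy_nonneg)
    then obtain L where "(\<lambda>n. a n / real n) \<longlonglongrightarrow> L"
      by (auto simp: convergent_def)
    then have L: "(\<lambda>n. ereal (1 / real n * a n)) \<longlonglongrightarrow> ereal L"
      by simp
    show ?thesis
      \<comment> \<open>Both quantities now concern the same convergent sequence, so
        \<open>limsup\<close> and \<open>lim\<close> both equal \<open>L\<close>. Convergence is
        essential for \<open>lim\<close>, which is a definite description.\<close>
      unfolding ip_entropy_partition_def ks_entropy_partition_def
        shannon_entropy_cylinder_partition[OF assms(2) P] a_def[symmetric]
      using lim_imp_Limsup[OF _ L] limI[OF L] by simp
  qed
  then show ?thesis
    unfolding ip_entropy_def ks_entropy_def by (intro SUP_cong) auto
qed

end
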